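(* Let $\sigma:\mathbb{R}\to\mathbb{R}$ satisfy $0\le\frac{\sigma(a)-\sigma(b)}{a-b}\le1$ for all $a\neq b$, let $L\ge1$, $\alpha\in(0,1]$, $\mathbf x\in\mathbb{R}^d$, and for $i=1,\dots,L$ let $\mathbf W_i\in\mathbb{R}^{n_i\times m}$ with $\|\mathbf W_i\|_2\le1$, $\mathbf U_i\in\mathbb{R}^{n_i\times d}$, $\mathbf b_i\in\mathbb{R}^{n_i}$. Let $\varphi_1,\dots,\varphi_L:\mathbb{R}^m\to\mathbb{R}\cup\{+\infty\}$ be proper convex functions such that $\operatorname{prox}_{\varphi_i}(\mathbf z)=\mathbf W_i^\top\sigma(\mathbf W_i\mathbf z+\mathbf U_i\mathbf x+\mathbf b_i)$ for all $\mathbf z\in\mathbb{R}^m$. Then any solution $\widetilde{\mathbf z}^*\in\mathbb{R}^{mL}$ of $$\widetilde{\mathbf z}=\alpha\widetilde{\mathbf W}^\top\sigma(\widetilde{\mathbf W}\mathbf P\widetilde{\mathbf z}+\widetilde{\mathbf U}\mathbf x+\widetilde{\mathbf b})+(1-\alpha)\mathbf P\widetilde{\mathbf z}$$ satisfies $$0\in\partial\Phi(\widetilde{\mathbf z}^* )+(\mathbf I-\mathbf P)\widetilde{\mathbf z}^*,\qquad \Phi(\widetilde{\mathbf z})=\sum_{i=1}^L\alpha M_{\varphi_i}^{1-\alpha}(\mathbf z_i),$$ where $\mathbf z_i\in\mathbb{R}^m$ denotes the $i$-th block of $\widetilde{\mathbf z}\in\mathbb{R}^{mL}$.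
   Context: $\sigma$ is applied element-wise. $\widetilde{\mathbf W}$ is the block diagonal matrix with diagonal blocks $\mathbf W_1,\dots,\mathbf W_L$; $\widetilde{\mathbf U}$ and $\widetilde{\mathbf b}$ are the vertical stackings of $\mathbf U_1,\dots,\mathbf U_L$ and $\mathbf b_1,\dots,\mathbf b_L$. $\mathbf P\in\mathbb{R}^{mL\times mL}$ is the block cyclic permutation: the first block of $\mathbf P\widetilde{\mathbf z}$ is the last block of $\widetilde{\mathbf z}$, and for $i\ge2$ the $i$-th block of $\mathbf P\widetilde{\mathbf z}$ is the $(i-1)$-th block of $\widetilde{\mathbf z}$. $\|\cdot\|$ is the Euclidean norm, $\|\cdot\|_2$ of a matrix the operator norm. For a proper convex $h$: $\partial h(\mathbf x)=\{\mathbf g: h(\mathbf y)\ge h(\mathbf x)+\langle\mathbf y-\mathbf x,\mathbf g\rangle\ \forall\mathbf y\}$; $\operatorname{prox}_h(\mathbf x)=\operatorname{argmin}_{\mathbf u}\{\frac12\|\mathbf u-\mathbf x\|^2+h(\mathbf u)\}$; the Moreau envelope is $M_h^\mu(\mathbf x)=\min_{\mathbf u}\{\frac1{2\mu}\|\mathbf u-\mathbf x\|^2+h(\mathbf u)\}$ for $\mu>0$, with the convention $M_h^0=h$. Under the stated assumptions on $\sigma$ and $\mathbf W_i$, functions $\varphi_i$ as described exist, for example $\varphi_i=\psi_i^*-\frac12\|\cdot\|^2$ with $\psi_i(\mathbf z)=\mathbf 1^\top\tilde\sigma(\mathbf W_i\mathbf z+\mathbf U_i\mathbf x+\mathbf b_i)$,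 $\tilde\sigma(a)=\int_0^a\sigma(t)\,dt$ element-wise, and $\psi_i^*$ the convex conjugate. *)

theory Defs
  imports "Jordan_Normal_Form.Matrix" "HOL-Library.Extended_Real"
begin

text \<open>
  The dimensions vary with the block index, so \<open>R\<^sup>n\<close> is the carrier set of real vectors of
  length \<open>n\<close>, and the \<open>L\<close> blocks are indexed by \<open>0, ..., L - 1\<close>. Functions with
  values in \<open>R \<union> {+\<infinity>}\<close> are functions into the extended reals; the value \<open>-\<infinity>\<close> is excluded
  by properness. Such functions matter only on the carrier set.
\<close>

definition enorm :: "real vec \<Rightarrow> real" where
  "enorm v = sqrt (v \<bullet> v)"

text \<open>At \<open>x = 0\<close> the quotient is \<open>0 / 0 = 0\<close>, which does not affect the supremum.\<close>

definition op_norm :: "real mat \<Rightarrow> real" where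
  "op_norm A = (SUP x\<in>carrier_vec (dim_col A). enorm (A *\<^sub>v x) / enorm x)"

definition block :: "nat \<Rightarrow> nat \<Rightarrow> 'a vec \<Rightarrow> 'a vec" where
  "block m i z = vec m (\<lambda>k. z $ (i * m + k))"

definition stack_vec :: "nat \<Rightarrow> (nat \<Rightarrow> 'a vec) \<Rightarrow> 'a vec" where
  "stack_vec L b = foldr (@\<^sub>v) (map b [0..<L]) vNil"

definition stack_mat :: "nat \<Rightarrow> nat \<Rightarrow> (nat \<Rightarrow> 'a :: zero mat) \<Rightarrow> 'a mat" where
  "stack_mat d L U = foldr (@\<^sub>r) (map U [0..<L]) (0\<^sub>m 0 d)"

definition block_diag :: "nat \<Rightarrow> (nat \<Rightarrow> 'a :: zero mat) \<Rightarrow> 'a mat" where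
  "block_diag L W = diag_block_mat (map W [0..<L])"

definition cyclic_perm_mat :: "nat \<Rightarrow> nat \<Rightarrow> real mat" where
  "cyclic_perm_mat m L = mat (m * L) (m * L)
     (\<lambda>(r, c). if r mod m = c mod m \<and> r div m = Suc (c div m) mod L then 1 else 0)"

lemma cyclic_perm_mat_carrier [simp]:
  "cyclic_perm_mat m L \<in> carrier_mat (m * L) (m * L)"
  by (simp add: cyclic_perm_mat_def)

lemma block_cyclic_perm_mat:
  assumes z: "z \<in> carrier_vec (m * L)" and i: "i < L"
  shows "block m i (cyclic_perm_mat m L *\<^sub>v z) = block m (if i = 0 then L - 1 else i - 1) z"
proof (rule eq_vecI)
  fix k assume "k < dim_vec (block m (if i = 0 then L - 1 else i - 1) z)"
  then have k: "k < m" by (simp add: block_def)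
  define j where "j = (if i = 0 then L - 1 else i - 1)"
  have j: "j < L" using i by (auto simp: j_def)
  have bound: "a * m + k < m * L" if "a < L" for a
  proof -
    have "a * m + k < Suc a * m" using k by simp
    also have "\<dots> \<le> L * m" using that by (intro mult_le_mono1) simp
    finally show ?thesis by (simp add: mult.commute)
  qed
  have pred: "i = Suc q mod L \<longleftrightarrow> q = j" if "q < L" for q
    using that i by (cases "Suc q = L") (auto simp: j_def)
  have eq: "(k = c mod m \<and> i = Suc (c div m) mod L) \<longleftrightarrow> c = j * m + k" if c: "c < m * L" for c
  proof -
    have "c div m < L" using c k by (simp add: less_mult_imp_div_less mult.commute)
    then have "(k = c mod m \<and> i = Suc (c div m) mod L) \<longleftrightarrow> k = c mod m \<and> c div m = j"
      using pred by blast
    also have "\<dots> \<longleftrightarrow> c = j * m + k"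
      using k by (metis div_mult_mod_eq div_mult_self3 div_less add.commute add_0 mod_mult_self3
          mod_less gr_implies_not0)
    finally show ?thesis .
  qed
  have "block m i (cyclic_perm_mat m L *\<^sub>v z) $ k
      = (\<Sum>c = 0..<m * L. (if k = c mod m \<and> i = Suc (c div m) mod L then 1 else 0) * z $ c)"
    using z k bound[OF i] by (simp add: block_def cyclic_perm_mat_def scalar_prod_def)
  also have "\<dots> = (\<Sum>c = 0..<m * L. if c = j * m + k then z $ c else 0)"
    by (intro sum.cong refl) (auto simp: eq)
  also have "\<dots> = z $ (j * m + k)"
    using bound[OF j] by simp
  finally show "block m i (cyclic_perm_mat m L *\<^sub>v z) $ k
      = block m (if i = 0 then L - 1 else i - 1) z $ k"
    using k unfolding j_def[symmetric] by (simp add: block_def)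
qed (simp add: block_def)

definition proper_convex :: "nat \<Rightarrow> (real vec \<Rightarrow> ereal) \<Rightarrow> bool" where
  "proper_convex n h \<longleftrightarrow>
     (\<forall>x\<in>carrier_vec n. h x \<noteq> -\<infinity>) \<and>
     (\<exists>x\<in>carrier_vec n. h x \<noteq> \<infinity>) \<and>
     (\<forall>x\<in>carrier_vec n. \<forall>y\<in>carrier_vec n. \<forall>t\<in>{0..1}.
        h ((1 - t) \<cdot>\<^sub>v x + t \<cdot>\<^sub>v y) \<le> ereal (1 - t) * h x + ereal t * h y)"

definition subdiff :: "nat \<Rightarrow> (real vec \<Rightarrow> ereal) \<Rightarrow> real vec \<Rightarrow> real vec set" where
  "subdiff n h x =
     {g \<in> carrier_vec n. \<forall>y\<in>carrier_vec n. h y \<ge> h x + ereal ((y - x) \<bullet> g)}"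

text \<open>
  The proximal operator is the set of minimizers, so that \<open>prox n h x = {p}\<close> asserts existence
  as well as uniqueness of the minimizer (lower semicontinuity of \<open>h\<close> is not assumed).
\<close>

definition prox :: "nat \<Rightarrow> (real vec \<Rightarrow> ereal) \<Rightarrow> real vec \<Rightarrow> real vec set" where
  "prox n h x =
     {u \<in> carrier_vec n. \<forall>v\<in>carrier_vec n.
        ereal (1 / 2 * (enorm (u - x))\<^sup>2) + h u \<le> ereal (1 / 2 * (enorm (v - x))\<^sup>2) + h v}"

text \<open>
  The minimum over \<open>u\<close> is written as an infimum in the extended reals, which agrees with it
  whenever the minimum is attained.
\<close>

definition moreau_env :: "nat \<Rightarrow> real \<Rightarrow> (real vec \<Rightarrow> ereal) \<Rightarrow> real vec \<Rightarrow> ereal" where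
  "moreau_env n \<mu> h x =
     (if \<mu> = 0 then h x
      else (INF u\<in>carrier_vec n. ereal (1 / (2 * \<mu>) * (enorm (u - x))\<^sup>2) + h u))"

end

theory Submission
  imports Defs
begin

text \<open>
  Write \<open>w i\<close> for the \<open>i\<close>-th block of \<open>P z\<close> and \<open>p i\<close> for the proximal point of \<open>w i\<close>. Blockwise,
  the fixed-point equation reads \<open>z i = \<alpha> p i + (1 - \<alpha>) w i = p i + (1 - \<alpha>) q i\<close> with
  \<open>q i = w i - p i\<close>. Minimality of \<open>p i\<close> gives \<open>q i \<in> \<partial>\<phi> i (p i)\<close>, and the Moreau envelope with
  parameter \<open>\<mu>\<close> carries this subgradient from \<open>p i\<close> to \<open>p i + \<mu> q i\<close>. Hence \<open>\<alpha> q i = w i - z i\<close>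
  are the blocks of a subgradient of \<open>\<Phi>\<close> at \<open>z\<close>, and this subgradient is \<open>P z - z\<close>.
\<close>

section \<open>Subgradients, proximal points and Moreau envelopes\<close>

lemma enorm_sq: "(enorm v)\<^sup>2 = v \<bullet> v" for v :: "real vec"
proof -
  have "0 \<le> v \<bullet> v" unfolding scalar_prod_def by (intro sum_nonneg) simp
  then show ?thesis by (simp add: enorm_def)
qed

lemma scalar_prod_self_nonneg: "0 \<le> v \<bullet> v" for v :: "real vec"
  using enorm_sq[of v] by (metis zero_le_power2)

lemma scalar_prod_add_smult_self:
  fixes a c :: "real vec"
  assumes "a \<in> carrier_vec n" "c \<in> carrier_vec n"
  shows "(a + t \<cdot>\<^sub>v c) \<bullet> (a + t \<cdot>\<^sub>v c) = a \<bullet> a + 2 * t * (a \<bullet> c) + t\<^sup>2 * (c \<bullet> c)"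
proof -
  have "(a + t \<cdot>\<^sub>v c) \<bullet> (a + t \<cdot>\<^sub>v c) = a \<bullet> a + t * (a \<bullet> c) + t * (c \<bullet> a) + t\<^sup>2 * (c \<bullet> c)"
    using assms by (simp add: add_scalar_prod_distrib[of _ n] scalar_prod_add_distrib[of _ n]
        algebra_simps power2_eq_square)
  then show ?thesis using comm_scalar_prod[OF assms] by simp
qed

text \<open>Properness supplies a point with finite objective, and the objective at \<open>p\<close>
  is no larger. Finiteness lets \<open>prox_subdiff\<close> compute with real numbers.\<close>

lemma prox_finite:
  assumes h: "proper_convex n h" and p: "p \<in> prox n h w"
  shows "\<bar>h p\<bar> \<noteq> \<infinity>"
proof -
  obtain v where v: "v \<in> carrier_vec n" "h v \<noteq> \<infinity>"
    using h by (auto simp: proper_convex_def)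
  have "h p \<noteq> -\<infinity>" using h p by (auto simp: proper_convex_def prox_def)
  moreover have "h p \<noteq> \<infinity>"
    using p v by (auto simp: prox_def dest!: bspec[of _ _ v])
  ultimately show ?thesis by auto
qed

text \<open>Compare the minimizer \<open>p\<close> with \<open>p + t (v - p)\<close>, divide by \<open>t\<close> and let \<open>t\<close> tend to \<open>0\<close>.\<close>

lemma prox_subdiff:
  assumes h: "proper_convex n h" and w: "w \<in> carrier_vec n" and p: "p \<in> prox n h w"
  shows "w - p \<in> subdiff n h p"
proof -
  have pc: "p \<in> carrier_vec n" using p by (simp add: prox_def)
  obtain hp where hp: "h p = ereal hp" using prox_finite[OF h p] by auto
  have "h p + ereal ((v - p) \<bullet> (w - p)) \<le> h v" if v: "v \<in> carrier_vec n" for v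
  proof (cases "h v")
    case (real hv)
    define a c where "a = p - w" and "c = v - p"
    have ac: "a \<in> carrier_vec n" "c \<in> carrier_vec n" using pc w v by (auto simp: a_def c_def)
    have step: "hp \<le> a \<bullet> c + t / 2 * (c \<bullet> c) + hv" if t: "0 < t" "t \<le> 1" for t
    proof -
      define u where "u = (1 - t) \<cdot>\<^sub>v p + t \<cdot>\<^sub>v v"
      have u: "u \<in> carrier_vec n" using pc v by (auto simp: u_def)
      have uw: "u - w = a + t \<cdot>\<^sub>v c"
        using pc w v by (auto simp: u_def a_def c_def algebra_simps)
      have "h u \<le> ereal (1 - t) * h p + ereal t * h v"
        using h pc v t by (auto simp: proper_convex_def u_def)
      then have hu: "h u \<le> ereal ((1 - t) * hp + t * hv)" by (simp add: hp real)
      have "ereal (1 / 2 * (a \<bullet> a)) + h p \<le> ereal (1 / 2 * ((u - w) \<bullet> (u - w))) + h u"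
        using p u by (auto simp: prox_def enorm_sq a_def)
      also have "\<dots> \<le> ereal (1 / 2 * ((u - w) \<bullet> (u - w))) + ereal ((1 - t) * hp + t * hv)"
        by (intro add_left_mono hu)
      finally have "1 / 2 * (a \<bullet> a) + hp
          \<le> 1 / 2 * (a \<bullet> a + 2 * t * (a \<bullet> c) + t\<^sup>2 * (c \<bullet> c)) + (1 - t) * hp + t * hv"
        by (simp add: hp uw scalar_prod_add_smult_self[OF ac])
      \<comment> \<open>The terms \<open>a \<bullet> a\<close> and \<open>hp\<close> cancel, and
        every remaining term carries a factor \<open>t\<close>.\<close>
      then have "t * hp \<le> t * (a \<bullet> c + t / 2 * (c \<bullet> c) + hv)"
        by (simp add: algebra_simps power2_eq_square)
      then show ?thesis using t by simp
    qed
    have "hp \<le> a \<bullet> c + hv"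
    proof (rule field_le_epsilon)
      fix e :: real assume e: "0 < e"
      \<comment> \<open>This choice keeps the error \<open>t / 2 * (c \<bullet> c)\<close> below
        \<open>e\<close>; the added 1 keeps the denominator positive even when \<open>c\<close> is
        the zero vector.\<close>
      define t where "t = min 1 (e / (c \<bullet> c + 1))"
      have cc: "0 \<le> c \<bullet> c" by (rule scalar_prod_self_nonneg)
      have t: "0 < t" "t \<le> 1" using e cc by (auto simp: t_def)
      have "t * (c \<bullet> c + 1) \<le> e / (c \<bullet> c + 1) * (c \<bullet> c + 1)"
        using cc by (intro mult_right_mono) (auto simp: t_def)
      then have "t * (c \<bullet> c + 1) \<le> e" using cc by simp
      moreover have "0 \<le> t * (c \<bullet> c)" using t cc by simp
      ultimately show "hp \<le> a \<bullet> c + hv + e"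
        using step[OF t] t by (simp add: algebra_simps)
    qed
    moreover have "a \<bullet> c = - ((v - p) \<bullet> (w - p))"
      using pc w v unfolding a_def c_def scalar_prod_def
      by (auto simp: sum_negf[symmetric] algebra_simps intro!: sum.cong)
    ultimately show ?thesis by (simp add: hp real)
  next
    case MInf
    then show ?thesis using h v by (auto simp: proper_convex_def)
  qed simp
  then show ?thesis using pc w by (simp add: subdiff_def)
qed

text \<open>At \<open>z = p + \<mu> q\<close> the candidate \<open>p\<close> bounds the envelope
  from above. At any other point \<open>y\<close>, each candidate \<open>u\<close> is bounded from
  below by the subgradient inequality at \<open>p\<close> and by completing a square, so the two
  bounds can be compared under the infimum. For \<open>\<mu> = 0\<close> the envelope is
  \<open>h\<close> and the point does not move.\<close>

lemma moreau_env_subdiff: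
  assumes mu: "0 \<le> \<mu>" and p: "p \<in> carrier_vec n" and q: "q \<in> subdiff n h p"
  shows "q \<in> subdiff n (moreau_env n \<mu> h) (p + \<mu> \<cdot>\<^sub>v q)"
proof (cases "\<mu> = 0")
  case True
  have "p + 0 \<cdot>\<^sub>v q = p" using p q by (auto simp: subdiff_def)
  then show ?thesis using True q by (simp add: moreau_env_def subdiff_def)
next
  case False
  then have mu: "0 < \<mu>" using mu by simp
  have qc: "q \<in> carrier_vec n" using q by (simp add: subdiff_def)
  define z where "z = p + \<mu> \<cdot>\<^sub>v q"
  have zc: "z \<in> carrier_vec n" using p qc by (simp add: z_def)
  have M: "moreau_env n \<mu> h y = (INF u\<in>carrier_vec n. ereal (1 / (2 * \<mu>) * ((u - y) \<bullet> (u - y))) + h u)"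
    for y using False by (simp add: moreau_env_def enorm_sq)
  have pz: "(p - z) \<bullet> (p - z) = \<mu>\<^sup>2 * (q \<bullet> q)"
    using p qc unfolding z_def scalar_prod_def
    by (auto simp: sum_distrib_left power2_eq_square algebra_simps intro!: sum.cong)
  have Mz: "moreau_env n \<mu> h z \<le> ereal (\<mu> / 2 * (q \<bullet> q)) + h p"
    unfolding M
    by (rule INF_lower2[OF p]) (use mu in \<open>simp add: pz power2_eq_square\<close>)
  have "moreau_env n \<mu> h z + ereal ((y - z) \<bullet> q) \<le> moreau_env n \<mu> h y"
    if y: "y \<in> carrier_vec n" for y
    unfolding M[of y]
  proof (rule INF_greatest)
    fix u :: "real vec" assume u: "u \<in> carrier_vec n"
    have uy: "u - y \<in> carrier_vec n" using u y by simp
    \<comment> \<open>Expanding the square of \<open>u - y + \<mu> q\<close> and dividing by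
      \<open>2 \<mu>\<close> gives a Young inequality for
      \<open>(u - y) \<bullet> q\<close>.\<close>
    have "0 \<le> (u - y) \<bullet> (u - y) + 2 * \<mu> * ((u - y) \<bullet> q) + \<mu>\<^sup>2 * (q \<bullet> q)"
      unfolding scalar_prod_add_smult_self[OF uy qc, symmetric] by (rule scalar_prod_self_nonneg)
    then have sq: "- ((u - y) \<bullet> q) - \<mu> / 2 * (q \<bullet> q) \<le> 1 / (2 * \<mu>) * ((u - y) \<bullet> (u - y))"
      using mu by (simp add: field_simps power2_eq_square)
    \<comment> \<open>Split \<open>u - p\<close> as \<open>(u - y) + (y - z) + (z - p)\<close>,
      where \<open>z - p\<close> is \<open>\<mu> q\<close>.\<close>
    have lin: "(u - p) \<bullet> q = (u - y) \<bullet> q + (y - z) \<bullet> q + \<mu> * (q \<bullet> q)"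
      using u y p qc unfolding z_def scalar_prod_def
      by (auto simp: sum_distrib_left sum.distrib[symmetric] algebra_simps intro!: sum.cong)
    have "moreau_env n \<mu> h z + ereal ((y - z) \<bullet> q)
        \<le> ereal (\<mu> / 2 * (q \<bullet> q)) + h p + ereal ((y - z) \<bullet> q)"
      by (intro add_right_mono Mz)
    \<comment> \<open>For finite \<open>h p\<close> this combines \<open>sq\<close> and
      \<open>lin\<close>; for infinite \<open>h p\<close> both sides are the same infinity.\<close>
    also have "\<dots> \<le> ereal (1 / (2 * \<mu>) * ((u - y) \<bullet> (u - y))) + (h p + ereal ((u - p) \<bullet> q))"
      using sq lin by (cases "h p") auto
    also have "\<dots> \<le> ereal (1 / (2 * \<mu>) * ((u - y) \<bullet> (u - y))) + h u"
      using q u by (intro add_left_mono) (auto simp: subdiff_def)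
    finally show "moreau_env n \<mu> h z + ereal ((y - z) \<bullet> q)
        \<le> ereal (1 / (2 * \<mu>) * ((u - y) \<bullet> (u - y))) + h u" .
  qed
  then show ?thesis using qc by (simp add: subdiff_def z_def)
qed

lemma subdiff_smult:
  assumes a: "0 \<le> a" and x: "x \<in> carrier_vec n" and g: "g \<in> subdiff n h x"
  shows "a \<cdot>\<^sub>v g \<in> subdiff n (\<lambda>y. ereal a * h y) x"
proof -
  have gc: "g \<in> carrier_vec n" using g by (simp add: subdiff_def)
  have "ereal a * h x + ereal ((y - x) \<bullet> (a \<cdot>\<^sub>v g)) \<le> ereal a * h y"
    if y: "y \<in> carrier_vec n" for y
  proof -
    have "(y - x) \<bullet> (a \<cdot>\<^sub>v g) = a * ((y - x) \<bullet> g)"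
      using gc x y by simp
    \<comment> \<open>The identity survives \<open>a = 0\<close> with infinite \<open>h x\<close>,
      because extended reals set \<open>0 * \<infinity>\<close> to 0.\<close>
    then have "ereal a * h x + ereal ((y - x) \<bullet> (a \<cdot>\<^sub>v g)) = ereal a * (h x + ereal ((y - x) \<bullet> g))"
      by (cases "h x") (auto simp: algebra_simps)
    also have "\<dots> \<le> ereal a * h y"
      using g y a by (intro ereal_mult_left_mono) (auto simp: subdiff_def)
    finally show ?thesis .
  qed
  then show ?thesis using gc by (simp add: subdiff_def)
qed

section \<open>Block vectors and block matrices\<close>

lemma block_carrier [simp]: "block m i v \<in> carrier_vec m"
  by (simp add: block_def)

lemma block_index_bound:
  fixes i k m L :: nat
  assumes "i < L" "k < m"
  shows "i * m + k < m * L"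
proof -
  have "i * m + k < Suc i * m" using assms by simp
  also have "\<dots> \<le> L * m" using assms by (intro mult_le_mono1) simp
  finally show ?thesis by (simp add: mult.commute)
qed

lemma block_add:
  assumes "v \<in> carrier_vec (m * L)" "w \<in> carrier_vec (m * L)" "i < L"
  shows "block m i (v + w) = block m i v + block m i w"
  using assms by (auto simp: block_def block_index_bound)

lemma block_diff:
  assumes "v \<in> carrier_vec (m * L)" "w \<in> carrier_vec (m * L)" "i < L"
  shows "block m i (v - w) = block m i v - block m i w"
  using assms by (auto simp: block_def block_index_bound)

lemma block_smult:
  assumes "v \<in> carrier_vec (m * L)" "i < L"
  shows "block m i (a \<cdot>\<^sub>v v) = a \<cdot>\<^sub>v block m i v"
  using assms by (auto simp: block_def block_index_bound)

text \<open>Entry \<open>k\<close> is entry \<open>k mod m\<close> of block \<open>k div m\<close>;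
  the existence of an index \<open>k\<close> forces \<open>m\<close> to be positive.\<close>

lemma eq_vec_blockI:
  assumes v: "v \<in> carrier_vec (m * L)" and w: "w \<in> carrier_vec (m * L)"
    and eq: "\<And>i. i < L \<Longrightarrow> block m i v = block m i w"
  shows "v = w"
proof (rule eq_vecI)
  fix k assume "k < dim_vec w"
  then have k: "k < m * L" using w by simp
  then have "0 < m" by (cases m) auto
  then have "k mod m < m" by simp
  moreover have "k div m < L" using k by (simp add: less_mult_imp_div_less mult.commute)
  ultimately have "block m (k div m) v $ (k mod m) = block m (k div m) w $ (k mod m)"
    by (simp add: eq)
  then show "v $ k = w $ k" using \<open>k mod m < m\<close> by (simp add: block_def)
qed (use v w in simp)

text \<open>The index range is cut into \<open>L\<close> consecutive intervals of length
  \<open>m\<close>, each shifted back to start at 0.\<close>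

lemma scalar_prod_blocks:
  assumes v: "v \<in> carrier_vec (m * L)" and w: "w \<in> carrier_vec (m * L)"
  shows "v \<bullet> w = (\<Sum>i<L. block m i v \<bullet> block m i w)"
proof -
  have "v \<bullet> w = (\<Sum>k<L * m. v $ k * w $ k)"
    using w by (simp add: scalar_prod_def atLeast0LessThan mult.commute)
  also have "\<dots> = (\<Sum>i<L. \<Sum>k = i * m..<i * m + m. v $ k * w $ k)"
    by (rule sum.nat_group[symmetric])
  also have "\<dots> = (\<Sum>i<L. block m i v \<bullet> block m i w)"
  proof (intro sum.cong refl)
    fix i
    have "(\<Sum>k = i * m..<i * m + m. v $ k * w $ k)
        = (\<Sum>k = 0..<m. v $ (k + i * m) * w $ (k + i * m))"
      using sum.shift_bounds_nat_ivl[of "\<lambda>k. v $ k * w $ k" 0 "i * m" m] by (simp add: add.commute)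
    also have "\<dots> = block m i v \<bullet> block m i w"
      by (auto simp: scalar_prod_def block_def add.commute intro!: sum.cong)
    finally show "(\<Sum>k = i * m..<i * m + m. v $ k * w $ k) = block m i v \<bullet> block m i w" .
  qed
  finally show ?thesis .
qed

text \<open>The inner product splits along the blocks, so the \<open>L\<close> subgradient
  inequalities simply add up.\<close>

lemma subdiff_separable:
  assumes g: "g \<in> carrier_vec (m * L)" and z: "z \<in> carrier_vec (m * L)"
    and sub: "\<And>i. i < L \<Longrightarrow> block m i g \<in> subdiff m (h i) (block m i z)"
  shows "g \<in> subdiff (m * L) (\<lambda>y. \<Sum>i<L. h i (block m i y)) z"
proof -
  have "(\<Sum>i<L. h i (block m i z)) + ereal ((y - z) \<bullet> g) \<le> (\<Sum>i<L. h i (block m i y))"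
    if y: "y \<in> carrier_vec (m * L)" for y
  proof -
    have "(y - z) \<bullet> g = (\<Sum>i<L. (block m i y - block m i z) \<bullet> block m i g)"
      using g y z by (simp add: scalar_prod_blocks[of _ m L] block_diff)
    then have "(\<Sum>i<L. h i (block m i z)) + ereal ((y - z) \<bullet> g)
        = (\<Sum>i<L. h i (block m i z) + ereal ((block m i y - block m i z) \<bullet> block m i g))"
      by (simp add: sum.distrib)
    also have "\<dots> \<le> (\<Sum>i<L. h i (block m i y))"
      using sub by (intro sum_mono) (auto simp: subdiff_def)
    finally show ?thesis .
  qed
  then show ?thesis using g by (simp add: subdiff_def)
qed

text \<open>The index list is arbitrary because induction on \<open>L\<close> in \<open>[0..<L]\<close> would add the new block at the wrong end of \<open>foldr\<close>.\<close>

definition stack_on :: "nat list \<Rightarrow> (nat \<Rightarrow> 'a vec) \<Rightarrow> 'a vec" where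
  "stack_on is f = foldr (@\<^sub>v) (map f is) vNil"

lemma stack_vec_eq: "stack_vec L f = stack_on [0..<L] f"
  by (simp add: stack_vec_def stack_on_def)

lemma stack_on_Nil [simp]: "stack_on [] f = vNil"
  by (simp add: stack_on_def)

lemma stack_on_Cons [simp]: "stack_on (i # is) f = f i @\<^sub>v stack_on is f"
  by (simp add: stack_on_def)

lemma dim_stack_on: "dim_vec (stack_on is f) = (\<Sum>i\<leftarrow>is. dim_vec (f i))"
  by (induction "is") auto

lemma map_vec_stack_on: "map_vec s (stack_on is f) = stack_on is (\<lambda>i. map_vec s (f i))"
proof (induction "is")
  case (Cons i "is")
  have "map_vec s (v @\<^sub>v w) = map_vec s v @\<^sub>v map_vec s w" for v w
    by (rule eq_vecI) auto
  then show ?case using Cons by simp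
qed auto

lemma stack_on_add:
  assumes "\<And>i. i \<in> set is \<Longrightarrow> dim_vec (f i) = dim_vec (g i)"
  shows "stack_on is f + stack_on is g = stack_on is (\<lambda>i. f i + g i)"
  using assms
proof (induction "is")
  case (Cons i "is")
  have len: "dim_vec (stack_on is f) = dim_vec (stack_on is g)"
    using Cons.prems by (simp add: dim_stack_on cong: map_cong)
  have "(f i @\<^sub>v stack_on is f) + (g i @\<^sub>v stack_on is g) = (f i + g i) @\<^sub>v (stack_on is f + stack_on is g)"
    using Cons.prems len by (intro eq_vecI) auto
  then show ?case using Cons by simp
qed auto

section \<open>Stacked and block diagonal matrices acting on vectors\<close>

lemma stack_rows_mult_vec:
  assumes "x \<in> carrier_vec d" "\<And>i. i \<in> set is \<Longrightarrow> U i \<in> carrier_mat (n i) d"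
  shows "foldr (@\<^sub>r) (map U is) (0\<^sub>m 0 d) \<in> carrier_mat (\<Sum>i\<leftarrow>is. n i) d \<and>
    foldr (@\<^sub>r) (map U is) (0\<^sub>m 0 d) *\<^sub>v x = stack_on is (\<lambda>i. U i *\<^sub>v x)"
  using assms(2)
proof (induction "is")
  case (Cons i "is")
  let ?B = "foldr (@\<^sub>r) (map U is) (0\<^sub>m 0 d)"
  have U: "U i \<in> carrier_mat (n i) d" using Cons.prems by simp
  \<comment> \<open>The dimensions are proved together with the product because
    \<open>mat_mult_append\<close> needs those of the tail.\<close>
  have B: "?B \<in> carrier_mat (\<Sum>i\<leftarrow>is. n i) d" "?B *\<^sub>v x = stack_on is (\<lambda>i. U i *\<^sub>v x)"
    using Cons by auto
  show ?case
    using mat_mult_append[OF U B(1) assms(1)] carrier_append_rows[OF U B(1)] B(2) by simp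
qed auto

lemma diag_block_mat_mult_stack_on:
  assumes "\<And>i. i \<in> set is \<Longrightarrow> f i \<in> carrier_vec (dim_col (A i))"
  shows "diag_block_mat (map A is) *\<^sub>v stack_on is f = stack_on is (\<lambda>i. A i *\<^sub>v f i)"
  using assms
proof (induction "is")
  case (Cons i "is")
  let ?B = "diag_block_mat (map A is)"
  have B: "?B \<in> carrier_mat (dim_row ?B) (dim_col ?B)" by auto
  have f: "f i \<in> carrier_vec (dim_col (A i))" using Cons.prems by simp
  have "dim_vec (f j) = dim_col (A j)" if "j \<in> set is" for j
    using Cons.prems[of j] that by simp
  then have s: "stack_on is f \<in> carrier_vec (dim_col ?B)"
    by (intro carrier_vecI) (simp add: dim_stack_on dim_diag_block_mat o_def cong: map_cong)
  have IH: "?B *\<^sub>v stack_on is f = stack_on is (\<lambda>i. A i *\<^sub>v f i)" using Cons by simp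
  \<comment> \<open>The two off-diagonal zero blocks contribute zero vectors, so head and tail do
    not interact.\<close>
  have "A i *\<^sub>v f i + 0\<^sub>m (dim_row (A i)) (dim_col ?B) *\<^sub>v stack_on is f = A i *\<^sub>v f i"
    using s by auto
  moreover have "0\<^sub>m (dim_row ?B) (dim_col (A i)) *\<^sub>v f i + ?B *\<^sub>v stack_on is f = ?B *\<^sub>v stack_on is f"
    using f by auto
  ultimately show ?case
    by (simp add: Let_def IH four_block_mat_mult_vec[where ?nr1.0 = "dim_row (A i)", OF _ _ _ B f s])
qed auto

lemma transpose_diag_block_mat:
  "(diag_block_mat As)\<^sup>T = diag_block_mat (map transpose_mat As)"
proof (induction As)
  case (Cons A As)
  \<comment> \<open>The induction hypothesis, read backwards, shows that the tail's dimensions swap,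
    so the transposed zero blocks have the right shape.\<close>
  have "dim_row (diag_block_mat (map transpose_mat As)) = dim_col (diag_block_mat As)"
    "dim_col (diag_block_mat (map transpose_mat As)) = dim_row (diag_block_mat As)"
    unfolding Cons.IH[symmetric] by auto
  then show ?case
    by (simp add: Let_def Cons.IH[symmetric]
        transpose_four_block_mat[of A "dim_row A" "dim_col A" _ "dim_col (diag_block_mat As)" _
          "dim_row (diag_block_mat As)"])
qed auto

section \<open>Stackings of vectors of equal length and their blocks\<close>

lemma stack_on_carrier:
  assumes "\<And>i. i \<in> set is \<Longrightarrow> f i \<in> carrier_vec m"
  shows "stack_on is f \<in> carrier_vec (m * length is)"
  using assms by (induction "is") auto

lemma block_stack_on:
  assumes "\<And>i. i \<in> set is \<Longrightarrow> f i \<in> carrier_vec m" and "j < length is"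
  shows "block m j (stack_on is f) = f (is ! j)"
  using assms
proof (induction "is" arbitrary: j)
  case (Cons i "is")
  have fi: "f i \<in> carrier_vec m" using Cons.prems by simp
  have s: "stack_on is f \<in> carrier_vec (m * length is)"
    using Cons.prems by (intro stack_on_carrier) simp
  show ?case
  proof (cases j)
    case 0
    then show ?thesis using fi s by (auto simp: block_def)
  next
    case (Suc l)
    then have l: "l < length is" using Cons.prems by simp
    \<comment> \<open>Removing the head shifts positions by \<open>m\<close>:
      \<open>Suc l * m + k = m + (l * m + k)\<close>.\<close>
    have "block m j (f i @\<^sub>v stack_on is f) = block m l (stack_on is f)"
      using fi s l block_index_bound[OF l] by (intro eq_vecI) (auto simp: block_def Suc)
    also have "\<dots> = f (is ! l)" using Cons.IH[OF _ l] Cons.prems by simp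
    finally show ?thesis by (simp add: Suc)
  qed
qed simp

lemma stack_vec_carrier:
  "(\<And>i. i < L \<Longrightarrow> f i \<in> carrier_vec m) \<Longrightarrow> stack_vec L f \<in> carrier_vec (m * L)"
  using stack_on_carrier[of "[0..<L]" f m] by (simp add: stack_vec_eq)

lemma block_stack_vec:
  "(\<And>i. i < L \<Longrightarrow> f i \<in> carrier_vec m) \<Longrightarrow> j < L \<Longrightarrow> block m j (stack_vec L f) = f j"
  using block_stack_on[of "[0..<L]" f m j] by (simp add: stack_vec_eq)

lemma stack_vec_blocks:
  assumes "z \<in> carrier_vec (m * L)"
  shows "stack_vec L (\<lambda>i. block m i z) = z"
  by (rule eq_vec_blockI[OF _ assms]) (simp_all add: stack_vec_carrier block_stack_vec)

text \<open>This decouples the fixed-point map into its layers. The hidden vectors have lengths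
  \<open>n i\<close> that may differ with \<open>i\<close>, so they are handled as stackings; only
  the input and the output are cut into blocks of length \<open>m\<close>.\<close>

lemma block_layers:
  assumes W: "\<And>i. i < L \<Longrightarrow> W i \<in> carrier_mat (n i) m"
    and U: "\<And>i. i < L \<Longrightarrow> U i \<in> carrier_mat (n i) d"
    and b: "\<And>i. i < L \<Longrightarrow> b i \<in> carrier_vec (n i)"
    and x: "x \<in> carrier_vec d" and y: "y \<in> carrier_vec (m * L)"
  shows "(block_diag L W)\<^sup>T *\<^sub>v map_vec s (block_diag L W *\<^sub>v y + stack_mat d L U *\<^sub>v x + stack_vec L b)
    = stack_vec L (\<lambda>i. (W i)\<^sup>T *\<^sub>v map_vec s (W i *\<^sub>v block m i y + U i *\<^sub>v x + b i))"
proof -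
  let ?is = "[0..<L]"
  have dims: "dim_row (W i) = n i" "dim_col (W i) = m" "dim_row (U i) = n i" "dim_vec (b i) = n i"
    if "i < L" for i using W[OF that] U[OF that] b[OF that] by auto
  have "block_diag L W *\<^sub>v y = block_diag L W *\<^sub>v stack_on ?is (\<lambda>i. block m i y)"
    using stack_vec_blocks[OF y] by (simp add: stack_vec_eq)
  also have "\<dots> = stack_on ?is (\<lambda>i. W i *\<^sub>v block m i y)"
    unfolding block_diag_def by (rule diag_block_mat_mult_stack_on) (simp add: dims)
  finally have Wy: "block_diag L W *\<^sub>v y = stack_on ?is (\<lambda>i. W i *\<^sub>v block m i y)" .
  have Ux: "stack_mat d L U *\<^sub>v x = stack_on ?is (\<lambda>i. U i *\<^sub>v x)"
    using stack_rows_mult_vec[OF x, of ?is U n] U by (simp add: stack_mat_def)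
  \<comment> \<open>Element-wise application commutes with stacking, which leaves two vector
    additions to merge.\<close>
  have inner: "map_vec s (block_diag L W *\<^sub>v y + stack_mat d L U *\<^sub>v x + stack_vec L b)
      = stack_on ?is (\<lambda>i. map_vec s (W i *\<^sub>v block m i y + U i *\<^sub>v x + b i))"
    unfolding Wy Ux stack_vec_eq map_vec_stack_on[symmetric]
    by (subst stack_on_add, simp add: dims)+ simp
  have transp: "(block_diag L W)\<^sup>T = diag_block_mat (map (\<lambda>i. (W i)\<^sup>T) ?is)"
    by (simp add: block_diag_def transpose_diag_block_mat o_def)
  show ?thesis
    unfolding inner transp unfolding stack_vec_eq
    by (rule diag_block_mat_mult_stack_on) (auto simp: dims intro!: carrier_vecI)
qed

theorem theorem2:
  fixes \<sigma> :: "real \<Rightarrow> real"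
    and L m d :: nat
    and n :: "nat \<Rightarrow> nat"
    and \<alpha> :: real
    and x :: "real vec"
    and W U :: "nat \<Rightarrow> real mat"
    and b :: "nat \<Rightarrow> real vec"
    and \<phi> :: "nat \<Rightarrow> real vec \<Rightarrow> ereal"
    and z :: "real vec"
  defines "Wt \<equiv> block_diag L W"
    and "Ut \<equiv> stack_mat d L U"
    and "bt \<equiv> stack_vec L b"
    and "P \<equiv> cyclic_perm_mat m L"
    and "\<Phi> \<equiv> \<lambda>y. \<Sum>i<L. ereal \<alpha> * moreau_env m (1 - \<alpha>) (\<phi> i) (block m i y)"
  assumes sigma: "\<forall>s t. s \<noteq> t \<longrightarrow> 0 \<le> (\<sigma> s - \<sigma> t) / (s - t) \<and> (\<sigma> s - \<sigma> t) / (s - t) \<le> 1"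
    and L: "L \<ge> 1"
    and alpha: "0 < \<alpha>" "\<alpha> \<le> 1"
    and x: "x \<in> carrier_vec d"
    and W: "\<forall>i<L. W i \<in> carrier_mat (n i) m \<and> op_norm (W i) \<le> 1"
    and U: "\<forall>i<L. U i \<in> carrier_mat (n i) d"
    and b: "\<forall>i<L. b i \<in> carrier_vec (n i)"
    and phi: "\<forall>i<L. proper_convex m (\<phi> i)"
    and prox: "\<forall>i<L. \<forall>v\<in>carrier_vec m.
      prox m (\<phi> i) v = {(W i)\<^sup>T *\<^sub>v map_vec \<sigma> (W i *\<^sub>v v + U i *\<^sub>v x + b i)}"
    and z: "z \<in> carrier_vec (m * L)"
    and fixpoint: "z = \<alpha> \<cdot>\<^sub>v (Wt\<^sup>T *\<^sub>v map_vec \<sigma> (Wt *\<^sub>v (P *\<^sub>v z) + Ut *\<^sub>v x + bt))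
      + (1 - \<alpha>) \<cdot>\<^sub>v (P *\<^sub>v z)"
  shows "0\<^sub>v (m * L) \<in> {g + (1\<^sub>m (m * L) - P) *\<^sub>v z | g. g \<in> subdiff (m * L) \<Phi> z}"
proof -
  define w where "w = P *\<^sub>v z"
  define p where "p i = (W i)\<^sup>T *\<^sub>v map_vec \<sigma> (W i *\<^sub>v block m i w + U i *\<^sub>v x + b i)" for i
  define q where "q i = block m i w - p i" for i
  have Pc: "P \<in> carrier_mat (m * L) (m * L)" by (simp add: P_def)
  have w: "w \<in> carrier_vec (m * L)" using Pc z by (simp add: w_def)
  have p_prox: "p i \<in> prox m (\<phi> i) (block m i w)" if "i < L" for i
    using prox that by (simp add: p_def)
  have p: "p i \<in> carrier_vec m" if "i < L" for i
    using p_prox[OF that] by (simp add: Defs.prox_def)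
  have z_eq: "z = \<alpha> \<cdot>\<^sub>v stack_vec L p + (1 - \<alpha>) \<cdot>\<^sub>v w"
    using fixpoint block_layers[of L W n m U d b x w \<sigma>] W U b x w
    by (simp add: Wt_def Ut_def bt_def w_def[symmetric] p_def[abs_def])
  have z_block: "block m i z = p i + (1 - \<alpha>) \<cdot>\<^sub>v q i" if i: "i < L" for i
  proof -
    have "block m i z = \<alpha> \<cdot>\<^sub>v p i + (1 - \<alpha>) \<cdot>\<^sub>v block m i w"
      using i p w by (subst z_eq) (simp add: block_add[of _ m L] block_smult[of _ m L]
          stack_vec_carrier block_stack_vec)
    \<comment> \<open>Substituting \<open>p i + q i\<close> for the block of \<open>w\<close> puts
      the point in the form that \<open>moreau_env_subdiff\<close> expects with
      \<open>\<mu> = 1 - \<alpha>\<close>.\<close>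
    also have "\<dots> = p i + (1 - \<alpha>) \<cdot>\<^sub>v q i"
      using p[OF i] by (auto simp: q_def block_def algebra_simps)
    finally show ?thesis .
  qed
  have "block m i (w - z) \<in> subdiff m (\<lambda>y. ereal \<alpha> * moreau_env m (1 - \<alpha>) (\<phi> i) y) (block m i z)"
    if i: "i < L" for i
  proof -
    have "q i \<in> subdiff m (\<phi> i) (p i)"
      using prox_subdiff[OF _ _ p_prox[OF i]] phi i by (simp add: q_def)
    \<comment> \<open>The parameter \<open>1 - \<alpha>\<close> is nonnegative and vanishes for
      \<open>\<alpha> = 1\<close>, where the envelope is \<open>\<phi> i\<close> itself.\<close>
    then have "q i \<in> subdiff m (moreau_env m (1 - \<alpha>) (\<phi> i)) (block m i z)"
      unfolding z_block[OF i] using alpha p[OF i] by (intro moreau_env_subdiff) auto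
    moreover have "block m i (w - z) = \<alpha> \<cdot>\<^sub>v q i"
    proof -
      have "block m i (w - z) = block m i w - (p i + (1 - \<alpha>) \<cdot>\<^sub>v q i)"
        using w z i by (simp add: block_diff[of _ m L] z_block)
      also have "\<dots> = \<alpha> \<cdot>\<^sub>v q i"
        using p[OF i] by (auto simp: q_def block_def algebra_simps)
      finally show ?thesis .
    qed
    ultimately show ?thesis using alpha by (simp add: subdiff_smult)
  qed
  then have "w - z \<in> subdiff (m * L) \<Phi> z"
    unfolding \<Phi>_def using w z by (intro subdiff_separable) auto
  moreover have "0\<^sub>v (m * L) = (w - z) + (1\<^sub>m (m * L) - P) *\<^sub>v z"
  proof -
    have "(1\<^sub>m (m * L) - P) *\<^sub>v z = z - w"
      using minus_mult_distrib_mat_vec[OF one_carrier_mat Pc z] z by (simp add: w_def)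
    then show ?thesis using w z by auto
  qed
  ultimately show ?thesis by blast
qed

end
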